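(* Every real number $x\in\mathbb{Z}+[1/2,1]$ (i.e. every real $x$ with $x-m\in[1/2,1]$ for some $m\in\mathbb{Z}$) can be represented as a sum of two continued fractions whose odd-order partial quotients are all equal to $1$: \[ x=[a_0;1,a_2,1,a_4,1,a_6,\ldots]+[b_0;1,b_2,1,b_4,1,b_6,\ldots], \] where $a_0,b_0\in\mathbb{Z}$ and $a_i,b_i\in\mathbb{N}=\{1,2,3,\ldots\}$ for $i>0$.
   Context: $[c_0;c_1,c_2,\ldots]$ denotes the (finite or infinite) regular continued fraction $c_0+\cfrac{1}{c_1+\cfrac{1}{c_2+\cdots}}$ with $c_0\in\mathbb{Z}$ and $c_i$ positive integers for $i\ge1$; the representation is allowed to be a finite continued fraction (terminating at some partial quotient). *)

theory Defs
  imports Complex_Main "HOL-Library.Extended_Nat"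
begin

text \<open>
  A regular continued fraction is given by a sequence \<open>c\<close> of partial quotients and the index
  \<open>N :: enat\<close> of its last one: \<open>N = enat n\<close> stands for \<open>[c\<^sub>0; c\<^sub>1, \<dots>, c\<^sub>n]\<close> and \<open>N = \<infinity>\<close> for the
  infinite \<open>[c\<^sub>0; c\<^sub>1, c\<^sub>2, \<dots>]\<close>.  Values of \<open>c\<close> beyond \<open>N\<close> are irrelevant.  A final partial
  quotient \<open>1\<close> is permitted.
\<close>

definition regular_cf :: "(nat \<Rightarrow> int) \<Rightarrow> enat \<Rightarrow> bool" where
  "regular_cf c N \<longleftrightarrow> (\<forall>i. 0 < i \<and> enat i \<le> N \<longrightarrow> 1 \<le> c i)"

fun cf_convergent :: "(nat \<Rightarrow> int) \<Rightarrow> nat \<Rightarrow> real" where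
  "cf_convergent c 0 = of_int (c 0)"
| "cf_convergent c (Suc n) = of_int (c 0) + 1 / cf_convergent (\<lambda>i. c (Suc i)) n"

definition cf_has_value :: "(nat \<Rightarrow> int) \<Rightarrow> enat \<Rightarrow> real \<Rightarrow> bool" where
  "cf_has_value c N x \<longleftrightarrow>
     (case N of enat n \<Rightarrow> cf_convergent c n = x
              | \<infinity> \<Rightarrow> cf_convergent c \<longlonglongrightarrow> x)"

definition odd_quotients_one :: "(nat \<Rightarrow> int) \<Rightarrow> enat \<Rightarrow> bool" where
  "odd_quotients_one c N \<longleftrightarrow> (\<forall>i. odd i \<and> enat i \<le> N \<longrightarrow> c i = 1)"

end

theory Submission
  imports Defs "HOL-Analysis.Analysis"
begin

text \<open>
  Since \<open>1 / (1 + 1 / y) = 1 - 1 / (y + 1)\<close>, the values \<open>[a; 1, a\<^sub>2, 1, a\<^sub>4, \<dots>]\<close> are the numbers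
  \<open>a + 1 - t\<close> with \<open>t = 0\<close> or \<open>t = 1 / (n - t')\<close>, where \<open>n = a\<^sub>2 + 2 \<ge> 3\<close> and \<open>t'\<close> is of the same
  kind.  So it suffices that every number in \<open>[0, 1/2]\<close> is a sum of two elements of the Cantor set
  \<open>D\<close> of these \<open>t\<close>.  The convex hull of \<open>D\<close> is \<open>[0, \<lambda>]\<close> with \<open>\<lambda> = (3 - \<surd>5) / 2\<close>, the fixed point
  of \<open>t \<mapsto> 1 / (3 - t)\<close>, and \<open>D + D\<close> is not an interval: Newhouse's gap condition fails at
  every scale.  But splitting always the bridge with the larger scale and, when this spoils the
  ratio of the scales, trimming the other bridge until the ratio is restored, one never leaves the
  set of pairs of bridges whose gaps are covered.  The sets of possible pairs at each finite depth
  are compact, so a pair of points of \<open>D\<close> with the required sum survives.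
\<close>

section \<open>Bridges of the Cantor set and their gaps\<close>

definition lam :: real where "lam = (3 - sqrt 5) / 2"

lemma lam_sq: "lam^2 = 3 * lam - 1"
  unfolding lam_def by (simp add: power2_eq_square field_simps)

lemma lam_bounds: "19/50 < lam" "lam < 191/500"
proof -
  have "sqrt 5 < 2.2362"
    by (rule real_less_lsqrt) (simp_all add: power2_eq_square)
  moreover have "2.236 < sqrt 5"
    by (rule real_less_rsqrt) (simp add: power2_eq_square)
  ultimately show "19/50 < lam" "lam < 191/500" unfolding lam_def by simp_all
qed

text \<open>
  A bridge consists of the numbers \<open>(p - p' t) / (q - q' t)\<close> where \<open>t \<in> D\<close> is \<open>0\<close> or has first digit
  at least \<open>n\<close>.  Measured from its left end it depends only on \<open>s = 1 / q\<^sup>2\<close> and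
  \<open>v = n - q' / q - \<lambda>\<close>: its length is \<open>s / v\<close>, and removing the pieces with first digit \<open>n\<close> replaces
  \<open>v\<close> by \<open>v + 1\<close>.  \<open>tail_sums k s v\<close> is the depth \<open>k\<close> approximation of this bridge from outside.
\<close>
fun tail_sums :: "nat \<Rightarrow> real \<Rightarrow> real \<Rightarrow> real set" where
  "tail_sums 0 s v = {0..s / v}"
| "tail_sums (Suc k) s v = tail_sums k s (v + 1) \<union>
     (\<lambda>u. s / (v + lam) + u) ` tail_sums k (s / (v + lam)^2) (3 - lam - 1 / (v + lam))"

text \<open>For the piece with first digit \<open>n\<close>, the quotient \<open>q' / q\<close>
  becomes \<open>1 / (v + lam)\<close>. The bound by \<open>lam\<close> persists because
  \<open>lam\<close> is the fixed point of \<open>1 / (3 - t)\<close>.\<close>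

lemma inverse_le_lam:
  assumes "3 - 2 * lam \<le> v"
  shows "1 / (v + lam) \<le> lam"
proof -
  have "lam * (3 - lam) \<le> lam * (v + lam)"
    using assms lam_bounds by (intro mult_left_mono) auto
  moreover have "lam * (3 - lam) = 1" using lam_sq by (simp add: power2_eq_square algebra_simps)
  ultimately show ?thesis using assms lam_bounds by (simp add: field_simps)
qed

lemma inverse_lam: "1 / lam = 3 - lam"
  using lam_bounds lam_sq by (simp add: field_simps power2_eq_square)

lemma first_piece_bounds:
  fixes v :: real
  assumes "3 - 2 * lam \<le> v"
  shows "3 - 2 * lam \<le> 3 - lam - 1 / (v + lam)" "3 - lam - 1 / (v + lam) \<le> 3 - lam"
  using inverse_le_lam[OF assms] assms lam_bounds by auto

text \<open>Since \<open>1 / lam = 3 - lam\<close>, the new parameter is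
  \<open>v' = v / (lam * (v + lam))\<close>. The identities give the length of the right part, its
  derivative at the right end, and that it ends where the bridge does.\<close>

lemma first_piece_identities:
  fixes s v :: real
  assumes "3 - 2 * lam \<le> v"
  defines "s' \<equiv> s / (v + lam)^2" and "v' \<equiv> 3 - lam - 1 / (v + lam)"
  shows "s' / v' = s * lam / (v * (v + lam))" "s' / v'^2 = lam^2 * s / v^2"
    "s / (v + lam) + s' / v' = s / v"
proof -
  have v: "v > 0" "v + lam > 0" "lam > 0" using assms lam_bounds by auto
  have v': "v' = v / (lam * (v + lam))"
    unfolding v'_def inverse_lam[symmetric] using v by (simp add: field_simps)
  show 1: "s' / v' = s * lam / (v * (v + lam))"
    unfolding v' s'_def using v by (simp add: power2_eq_square mult_ac)
  have "s' / v'^2 = s / (v + lam)^2 * (lam^2 * (v + lam)^2) / v^2"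
    unfolding v' s'_def by (simp add: power_mult_distrib power_divide)
  also have "\<dots> = lam^2 * s / v^2" using v by simp
  finally show "s' / v'^2 = lam^2 * s / v^2" .
  show "s / (v + lam) + s' / v' = s / v"
  proof -
    have "s / (v + lam) = s * v / (v * (v + lam))" using v by simp
    then have "s / (v + lam) + s' / v' = s * (v + lam) / (v * (v + lam))"
      unfolding 1 by (simp only: add_divide_distrib[symmetric] distrib_left[symmetric])
    then show ?thesis using v by simp
  qed
qed

lemma tail_sums_Suc_subset:
  assumes "s > 0" "3 - 2 * lam \<le> v"
  shows "tail_sums (Suc k) s v \<subseteq> tail_sums k s v"
  using assms
proof (induction k arbitrary: s v)
  case 0
  define s' v' where "s' = s / (v + lam)^2" and "v' = 3 - lam - 1 / (v + lam)"
  note fp = first_piece_bounds[OF 0(2), folded v'_def]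
    first_piece_identities[OF 0(2), of s, folded s'_def v'_def]
  have v: "v > 0" "v + lam > 0" using 0 lam_bounds by auto
  have "s / (v + 1) \<le> s / v" "s / (v + lam) \<ge> 0" using v 0 by (auto intro!: divide_left_mono)
  then show ?case using fp(5) by (auto simp flip: s'_def v'_def)
next
  case (Suc k)
  define s' v' where "s' = s / (v + lam)^2" and "v' = 3 - lam - 1 / (v + lam)"
  note fp = first_piece_bounds[OF Suc.prems(2), folded v'_def]
    first_piece_identities[OF Suc.prems(2), of s, folded s'_def v'_def]
  have "s' > 0" unfolding s'_def using Suc.prems lam_bounds by simp
  have "tail_sums (Suc k) s (v + 1) \<subseteq> tail_sums k s (v + 1)"
    "tail_sums (Suc k) s' v' \<subseteq> tail_sums k s' v'"
    using Suc.IH[of s "v + 1"] Suc.IH[of s' v'] Suc.prems fp(1) \<open>s' > 0\<close> by auto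
  then show ?case
    unfolding tail_sums.simps(2)[of "Suc k" s v] tail_sums.simps(2)[of k s v]
    by (auto simp del: tail_sums.simps simp flip: s'_def v'_def)
qed

text \<open>Raising \<open>v\<close> discards small first digits, so a trimmed bridge may stand in
  for the full one without loss of depth.\<close>

lemma tail_sums_shift_subset:
  assumes "s > 0" "3 - 2 * lam \<le> v"
  shows "tail_sums k s (v + real i) \<subseteq> tail_sums k s v"
proof (induction i)
  case (Suc i)
  have "tail_sums k s (v + real (Suc i)) \<subseteq> tail_sums (Suc k) s (v + real i)"
    by (auto simp: add_ac)
  also have "\<dots> \<subseteq> tail_sums k s (v + real i)"
    using assms by (intro tail_sums_Suc_subset) auto
  finally show ?case using Suc by blast
qed simp

section \<open>Splitting and trimming balanced pairs of bridges\<close>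

text \<open>
  The conditions, in order: the gap of the second bridge is at most the right part of the first;
  the gap of the first is at most the second bridge; and the ratio \<open>r\<close> of the derivatives
  \<open>s / v\<^sup>2\<close>, \<open>z / w\<^sup>2\<close> at the right ends satisfies \<open>3/2 \<le> r \<le> 2/(3\<lambda>\<^sup>2)\<close>.  Passing to the right part
  multiplies the derivative by exactly \<open>\<lambda>\<^sup>2\<close>, so that after exchanging the bridges \<open>r\<close> becomes
  \<open>1/(\<lambda>\<^sup>2 r)\<close>, which lies in the same range.
\<close>
definition balanced :: "real \<Rightarrow> real \<Rightarrow> real \<Rightarrow> real \<Rightarrow> bool" where
  "balanced s v z w \<longleftrightarrow> 0 < s \<and> 0 < z \<and> 3 - 2 * lam \<le> v \<and> 3 - 2 * lam \<le> w \<and>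
     z * (1 - lam) / ((w + lam) * (w + 1)) \<le> s * lam / (v * (v + lam)) \<and>
     s * (1 - lam) / ((v + lam) * (v + 1)) \<le> z / w \<and>
     3/2 * (z / w^2) \<le> s / v^2 \<and> 3/2 * (lam^2 * s / v^2) \<le> z / w^2"

text \<open>The bridges exchange roles. The two ratio bounds turn into each other, and the old first
  gap condition becomes the new second one. Only the new first one needs an estimate, which rests on
  the factor \<open>3/2\<close> in the ratio bound.\<close>

lemma balanced_first_piece:
  assumes "balanced s v z w"
  shows "balanced z w (s / (v + lam)^2) (3 - lam - 1 / (v + lam))"
proof -
  define s' v' where "s' = s / (v + lam)^2" and "v' = 3 - lam - 1 / (v + lam)"
  have A: "0 < s" "0 < z" "3 - 2 * lam \<le> v" "3 - 2 * lam \<le> w"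
     "z * (1 - lam) / ((w + lam) * (w + 1)) \<le> s * lam / (v * (v + lam))"
     "3/2 * (z / w^2) \<le> s / v^2" "3/2 * (lam^2 * s / v^2) \<le> z / w^2"
    using assms unfolding balanced_def by auto
  note fp = first_piece_bounds[OF A(3), folded v'_def]
    first_piece_identities[OF A(3), of s, folded s'_def v'_def]
  have pos: "s' > 0" "v' > 0" "w > 0" "lam > 0"
    unfolding s'_def using A fp lam_bounds by auto
  have "v'^2 \<le> 3 * v'" using fp(2) pos by (simp add: power2_eq_square)
  \<comment> \<open>The new gap condition reduces to this once \<open>s'\<close> is replaced by its
    upper bound \<open>2/3 * z * v'^2 / w^2\<close>.\<close>
  then have 1: "(1 - lam) * v'^2 * (w + lam) \<le> 3/2 * lam * w * ((v' + lam) * (v' + 1))"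
  proof -
    have "w + lam \<le> (6/5) * w" using A lam_bounds by simp
    then have "(1 - lam) * v'^2 * (w + lam) \<le> (31/50) * v'^2 * ((6/5) * w)"
      using pos lam_bounds by (intro mult_mono) auto
    also have "\<dots> \<le> 3/2 * (19/50) * w * ((v' + lam) * (v' + 1))"
    proof -
      have "(31/50) * (6/5) * v'^2 \<le> 3/2 * (19/50) * (v'^2 + (69/50) * v')"
        using \<open>v'^2 \<le> 3 * v'\<close> pos by simp
      also have "\<dots> \<le> 3/2 * (19/50) * ((v' + lam) * (v' + 1))"
      proof (rule mult_left_mono)
        have "19/50 * v' \<le> lam * v'" using lam_bounds pos by (intro mult_right_mono) auto
        moreover have "(v' + lam) * (v' + 1) = v'^2 + v' + lam * v' + lam"
          by (simp add: power2_eq_square algebra_simps)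
        ultimately show "v'^2 + 69/50 * v' \<le> (v' + lam) * (v' + 1)" using pos by linarith
      qed simp
      finally show ?thesis using pos by (simp add: mult.assoc mult.left_commute mult_left_mono)
    qed
    also have "\<dots> \<le> 3/2 * lam * w * ((v' + lam) * (v' + 1))"
      using lam_bounds pos by (intro mult_right_mono) auto
    finally show ?thesis .
  qed
  have "3/2 * (s' / v'^2) \<le> z / w^2" using A(7) fp(4) by simp
  then have "s' \<le> 2/3 * z * v'^2 / w^2" using pos by (simp add: field_simps)
  then have "s' * (1 - lam) / ((v' + lam) * (v' + 1)) \<le>
     (2/3 * z * v'^2 / w^2) * (1 - lam) / ((v' + lam) * (v' + 1))"
    using pos lam_bounds by (intro divide_right_mono mult_right_mono) auto
  also have "\<dots> \<le> z * lam / (w * (w + lam))"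
  proof -
    have "(2/3 * z * v'^2 / w^2) * (1 - lam) / ((v' + lam) * (v' + 1))
        = z * 2/3 * ((1 - lam) * v'^2 * (w + lam)) / (w^2 * (w + lam) * ((v' + lam) * (v' + 1)))"
      using pos by (simp add: mult_ac)
    also have "\<dots> \<le> z * 2/3 * (3/2 * lam * w * ((v' + lam) * (v' + 1)))
        / (w^2 * (w + lam) * ((v' + lam) * (v' + 1)))"
      using 1 pos A by (intro divide_right_mono mult_left_mono) auto
    also have "\<dots> = z * lam / (w * (w + lam))"
    proof -
      define P where "P = (v' + lam) * (v' + 1)"
      have "P > 0" unfolding P_def using pos by simp
      then show ?thesis unfolding P_def[symmetric] using pos by (simp add: power2_eq_square mult_ac)
    qed
    finally show ?thesis .
  qed
  finally have q1: "s' * (1 - lam) / ((v' + lam) * (v' + 1)) \<le> z * lam / (w * (w + lam))" .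
  have "lam^2 * z / w^2 * (3/2) \<le> lam^2 * (s / v^2)"
    using mult_left_mono[OF A(6), of "lam^2"] by (simp add: mult_ac)
  then have q4: "3/2 * (lam^2 * z / w^2) \<le> s' / v'^2" using fp(4) by simp
  show ?thesis unfolding balanced_def s'_def[symmetric] v'_def[symmetric]
    using A pos fp q1 q4 by simp
qed

text \<open>Discarding the right part of the first bridge may violate the two conditions that bound
  the second bridge from above; trimming the second restores them. The extra conclusion keeps the
  old gap of the first bridge covered.\<close>

lemma balanced_shift:
  assumes "balanced s v z w"
  obtains i :: nat where "balanced s (v + 1) z (w + real i)"
    "s * (1 - lam) / ((v + lam) * (v + 1)) \<le> z / (w + real i)"
proof -
  have A: "0 < s" "0 < z" "3 - 2 * lam \<le> v" "3 - 2 * lam \<le> w"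
     "s * (1 - lam) / ((v + lam) * (v + 1)) \<le> z / w"
     "3/2 * (lam^2 * s / v^2) \<le> z / w^2"
    using assms unfolding balanced_def by auto
  have l: "19/50 < lam" "lam < 191/500" "0 < lam" using lam_bounds by auto
  \<comment> \<open>\<open>3 - 2 * lam\<close> is \<open>sqrt 5\<close>.\<close>
  have vw: "v > 2.236" "w > 2.236" using A l by auto
  define P where "P i \<longleftrightarrow>
     z * (1 - lam) / ((w + real i + lam) * (w + real i + 1)) \<le> s * lam / ((v + 1) * (v + 1 + lam)) \<and>
     3/2 * (z / (w + real i)^2) \<le> s / (v + 1)^2" for i
  have "\<exists>i. P i"
  proof -
    define e where "e = min (s * lam / ((v + 1) * (v + 1 + lam))) (s / (v + 1)^2)"
    have "e > 0" unfolding e_def using A l vw by simp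
    obtain i :: nat where i: "3/2 * z / e < real i" using reals_Archimedean2 by blast
    define W where "W = w + real i"
    have W: "W > 1" "3/2 * z / e \<le> W" unfolding W_def using i vw by auto
    then have 1: "3/2 * z / W \<le> e" using \<open>e > 0\<close> by (simp add: field_simps)
    have "z * (1 - lam) / ((W + lam) * (W + 1)) \<le> z * 1 / (W * 1)"
      using A l W by (intro frac_le mult_mono) auto
    also have "\<dots> \<le> e" using 1 A W by (simp add: field_simps)
    finally have 2: "z * (1 - lam) / ((W + lam) * (W + 1)) \<le> e" .
    have "3/2 * (z / W^2) \<le> 3/2 * z / W"
      using W A by (simp add: power2_eq_square field_simps)
    with 1 2 have "P i" unfolding P_def W_def[symmetric] e_def by auto
    then show ?thesis ..
  qed
  \<comment> \<open>By minimality the trimmed bridge is still long enough to cover the gap of the first one.\<close>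
  define i where "i = (LEAST i. P i)"
  have Pi: "P i" unfolding i_def using \<open>\<exists>i. P i\<close> by (rule LeastI_ex)
  define X where "X = w + real i"
  have "s * (1 - lam) / ((v + lam) * (v + 1)) \<le> z / X \<and> 3/2 * (lam^2 * s / (v + 1)^2) \<le> z / X^2"
  proof (cases i)
    case 0
    have "lam^2 * s / (v + 1)^2 \<le> lam^2 * s / v^2"
      using vw A by (intro divide_left_mono power_mono) auto
    then show ?thesis using A 0 unfolding X_def by simp
  next
    case (Suc j)
    define W where "W = w + real j"
    have XW: "X = W + 1" unfolding X_def W_def Suc by simp
    have W: "W > 2.236" unfolding W_def using vw by simp
    \<comment> \<open>Before the last trimming step one condition failed. Either failure bounds
      \<open>s\<close> by a multiple of \<open>z\<close>, with enough room to pass from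
      \<open>W\<close> to \<open>W + 1\<close>.\<close>
    have "\<not> P j" using Suc not_less_Least[of j P] unfolding i_def by simp
    then consider
      (a) "s * lam / ((v + 1) * (v + 1 + lam)) < z * (1 - lam) / ((W + lam) * (W + 1))" |
      (b) "s / (v + 1)^2 < 3/2 * (z / W^2)"
      unfolding P_def W_def by linarith
    then show ?thesis
    proof cases
      case a
      define t where "t = z * (1 - lam) * (v + 1 + lam) / (lam * (W + lam) * (W + 1))"
      have "s / (v + 1) = s * lam / ((v + 1) * (v + 1 + lam)) * ((v + 1 + lam) / lam)"
        using vw l by simp
      also have "\<dots> \<le> z * (1 - lam) / ((W + lam) * (W + 1)) * ((v + 1 + lam) / lam)"
        using a vw l by (intro mult_right_mono) auto
      also have "\<dots> = t" unfolding t_def by (simp add: mult_ac)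
      finally have 1: "s / (v + 1) \<le> t" .
      have "t \<ge> 0" unfolding t_def using A l vw W by simp
      \<comment> \<open>Thus the two gap factors \<open>1 - lam\<close> cancel the
        \<open>lam\<close> in the denominator of \<open>t\<close>.\<close>
      have "(1 - lam)^2 = lam" using lam_sq by (simp add: power2_eq_square algebra_simps)
      have "s * (1 - lam) / ((v + lam) * (v + 1)) = (s / (v + 1)) * ((1 - lam) / (v + lam))"
        by simp
      also have "\<dots> \<le> t * ((1 - lam) / (v + lam))"
        using 1 l vw by (intro mult_right_mono) auto
      also have "\<dots> = z * (1 - lam)^2 / lam * (v + 1 + lam) / ((W + lam) * (W + 1) * (v + lam))"
        unfolding t_def by (simp add: power2_eq_square mult_ac)
      also have "\<dots> = (z / (W + 1)) * ((v + 1 + lam) / ((W + lam) * (v + lam)))"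
        unfolding \<open>(1 - lam)^2 = lam\<close> using l by simp
      also have "\<dots> \<le> (z / (W + 1)) * 1"
      proof (intro mult_left_mono)
        have "v + 1 + lam \<le> 2 * (v + lam)" using vw l by simp
        also have "\<dots> \<le> (W + lam) * (v + lam)" using W vw l by (intro mult_right_mono) auto
        finally show "(v + 1 + lam) / ((W + lam) * (v + lam)) \<le> 1"
          using W vw l by (simp add: divide_le_eq_1)
      qed (use A W in auto)
      finally have 2: "s * (1 - lam) / ((v + lam) * (v + 1)) \<le> z / X" unfolding XW by simp
      have "3/2 * (lam^2 * s / (v + 1)^2) = (3/2 * lam^2 / (v + 1)) * (s / (v + 1))"
        by (simp only: divide_inverse power2_eq_square inverse_mult_distrib mult_ac)
      also have "\<dots> \<le> (3/2 * lam^2 / (v + 1)) * t"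
        using 1 l vw by (intro mult_left_mono) auto
      also have "\<dots> = (z / (W + 1)) * ((3/2 * lam * (1 - lam)) * ((v + 1 + lam) / (v + 1)) / (W + lam))"
        unfolding t_def using l by (simp add: power2_eq_square mult_ac) (simp add: algebra_simps)
      also have "\<dots> \<le> (z / (W + 1)) * (1/2 / (W + lam))"
      proof (intro mult_left_mono divide_right_mono)
        have "lam * (1 - lam) = 1 - 2 * lam" using lam_sq by (simp add: power2_eq_square algebra_simps)
        then have "3/2 * lam * (1 - lam) \<le> 0.36" using l by (simp add: mult.assoc)
        moreover have "(v + 1 + lam) / (v + 1) \<le> 1.2" using vw l by (simp add: field_simps)
        ultimately have "(3/2 * lam * (1 - lam)) * ((v + 1 + lam) / (v + 1)) \<le> 0.36 * 1.2"
          using l vw by (intro mult_mono) auto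
        then show "(3/2 * lam * (1 - lam)) * ((v + 1 + lam) / (v + 1)) \<le> 1/2" by simp
      qed (use A W l in auto)
      also have "\<dots> \<le> (z / (W + 1)) * (1 / (W + 1))"
        using A W l by (intro mult_left_mono) (auto simp: field_simps)
      finally have "3/2 * (lam^2 * s / (v + 1)^2) \<le> z / X^2"
        unfolding XW by (simp add: power2_eq_square)
      with 2 show ?thesis by simp
    next
      case b
      have W2: "2.236 * W \<le> W^2" using W by (simp add: power2_eq_square)
      have "s * (1 - lam) / ((v + lam) * (v + 1))
          = (s / (v + 1)^2) * ((1 - lam) * ((v + 1) / (v + lam)))"
        using vw by (simp add: power2_eq_square)
      also have "\<dots> \<le> (3/2 * (z / W^2)) * ((31/50) * 1.3)"
      proof (intro mult_mono)
        show "(v + 1) / (v + lam) \<le> 1.3" using vw l by (simp add: field_simps)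
      qed (use b A W l vw in auto)
      also have "\<dots> \<le> z / (W + 1)"
        using A W W2 mult_left_mono[of "1.209 * (W + 1)" "W^2" z] by (simp add: field_simps)
      finally have 2: "s * (1 - lam) / ((v + lam) * (v + 1)) \<le> z / X" unfolding XW .
      have "3/2 * (lam^2 * s / (v + 1)^2) = 3/2 * lam^2 * (s / (v + 1)^2)" by simp
      \<comment> \<open>\<open>0.146 = 3 * 0.382 - 1\<close> bounds \<open>lam^2\<close>; the
        product of the constants is the \<open>657/2000\<close> below.\<close>
      also have "\<dots> \<le> 3/2 * 0.146 * (3/2 * (z / W^2))"
        using b A l lam_sq by (intro mult_mono) auto
      also have "\<dots> \<le> z / (W + 1)^2"
      proof -
        have "(W + 1)^2 \<le> (29/20 * W)^2" using W by (intro power_mono) auto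
        then have "(W + 1)^2 \<le> 841/400 * W^2" by (simp add: power_mult_distrib power2_eq_square)
        moreover have "0 \<le> W^2" by simp
        ultimately have "657/2000 * (W + 1)^2 \<le> W^2" by linarith
        then show ?thesis using A W mult_left_mono[of "657/2000 * (W + 1)^2" "W^2" z]
          by (simp add: field_simps)
      qed
      finally show ?thesis using 2 unfolding XW by simp
    qed
  qed
  moreover have "s * (1 - lam) / ((v + 1 + lam) * (v + 1 + 1)) \<le> s * (1 - lam) / ((v + lam) * (v + 1))"
    using A l vw by (intro divide_left_mono mult_mono mult_nonneg_nonneg) auto
  ultimately have "balanced s (v + 1) z X \<and> s * (1 - lam) / ((v + lam) * (v + 1)) \<le> z / X"
    using Pi A unfolding balanced_def P_def X_def by auto
  then show ?thesis using that unfolding X_def by blast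
qed

text \<open>If \<open>x\<close> reaches the right part of the first bridge, that part is kept, and
  the largest possible sum is unchanged. Otherwise the left part is kept, and the trimmed second
  bridge covers the gap up to \<open>s / (v + lam)\<close>.\<close>

lemma balanced_step:
  assumes "balanced s v z w" "0 \<le> x" "x \<le> s / v + z / w"
  obtains
    "s / (v + lam) \<le> x" "balanced z w (s / (v + lam)^2) (3 - lam - 1 / (v + lam))"
    "x - s / (v + lam) \<le> z / w + s / (v + lam)^2 / (3 - lam - 1 / (v + lam))"
  | i :: nat where "balanced s (v + 1) z (w + real i)" "x \<le> s / (v + 1) + z / (w + real i)"
proof (cases "s / (v + lam) \<le> x")
  case True
  have "3 - 2 * lam \<le> v" using assms(1) unfolding balanced_def by auto
  from first_piece_identities(3)[OF this, of s] show ?thesis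
    using that(1) True balanced_first_piece[OF assms(1)] assms(3) by simp
next
  case False
  obtain i where i: "balanced s (v + 1) z (w + real i)"
    "s * (1 - lam) / ((v + lam) * (v + 1)) \<le> z / (w + real i)"
    using balanced_shift[OF assms(1)] .
  have "v > 0" "v + lam > 0" using assms(1) lam_bounds unfolding balanced_def by auto
  then have "s / (v + lam) = s / (v + 1) + s * (1 - lam) / ((v + lam) * (v + 1))"
    by (simp add: divide_simps) (simp add: algebra_simps)
  then show ?thesis using that(2)[OF i(1)] i(2) False by linarith
qed

text \<open>Induction on \<open>k + j\<close> with separate depths: keeping a right part exchanges
  the bridges, so \<open>S (Suc k) j\<close> needs both \<open>S j k\<close> and
  \<open>S k j\<close>.\<close>

lemma balanced_sum_surj:
  assumes "balanced s v z w" "0 \<le> x" "x \<le> s / v + z / w"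
  shows "\<exists>p \<in> tail_sums k s v. \<exists>q \<in> tail_sums j z w. x = p + q"
proof -
  define S where "S k j \<longleftrightarrow> (\<forall>s v z w x. balanced s v z w \<longrightarrow> 0 \<le> x \<longrightarrow> x \<le> s / v + z / w \<longrightarrow>
    (\<exists>p \<in> tail_sums k s v. \<exists>q \<in> tail_sums j z w. x = p + q))" for k j
  have SD: "\<exists>p \<in> tail_sums k s v. \<exists>q \<in> tail_sums j z w. x = p + q"
    if "S k j" "balanced s v z w" "0 \<le> x" "x \<le> s / v + z / w" for k j s v z w x
    using that unfolding S_def by blast
  have z: "z > 0" "3 - 2 * lam \<le> w" if "balanced s v z w" for s v z w
    using that unfolding balanced_def by auto
  have first: "S (Suc k) j" if Sjk: "S j k" and Skj: "S k j" for k j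
    unfolding S_def
  proof (intro allI impI)
    fix s v z w x assume *: "balanced s v z w" "0 \<le> x" "x \<le> s / v + z / w"
    from * show "\<exists>p \<in> tail_sums (Suc k) s v. \<exists>q \<in> tail_sums j z w. x = p + q"
    proof (cases rule: balanced_step)
      case 1
      then obtain q p where "q \<in> tail_sums j z w" "x - s / (v + lam) = q + p"
        "p \<in> tail_sums k (s / (v + lam)^2) (3 - lam - 1 / (v + lam))"
        using SD[OF Sjk 1(2), of "x - s / (v + lam)"] by auto
      then show ?thesis by (intro bexI[of _ "s / (v + lam) + p"] bexI[of _ q]) auto
    next
      case (2 i)
      from SD[OF Skj 2(1) *(2) 2(2)] show ?thesis
        using tail_sums_shift_subset[OF z[OF *(1)], of j i] by fastforce
    qed
  qed
  \<comment> \<open>Only the first bridge is sure to be split, but doing this repeatedly without splitting the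
     second one decreases the ratio of the scales, which is bounded below.\<close>
  have zero: "S 0 (Suc j)" if Sj0: "S j 0" and S0j: "S 0 j" for j
  proof -
    \<comment> \<open>\<open>N\<close> bounds how often the first bridge can lose a digit while the
      second stays untrimmed; for \<open>N = 0\<close> the last assumption contradicts the ratio
      bound.\<close>
    have "\<exists>p \<in> tail_sums 0 s v. \<exists>q \<in> tail_sums (Suc j) z w. x = p + q"
      if "balanced s v z w" "0 \<le> x" "x \<le> s / v + z / w"
        "s / (v + real N)^2 < 3/2 * (z / w^2)" for N s v z w x
      using that
    proof (induction N arbitrary: s v z w x)
      case 0
      then show ?case unfolding balanced_def by auto
    next
      case (Suc N)
      note zw = z[OF Suc.prems(1)]
      have sv: "s > 0" "3 - 2 * lam \<le> v" using Suc.prems(1) unfolding balanced_def by auto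
      have sub: "tail_sums 0 s (v + 1) \<subseteq> tail_sums 0 s v"
        using tail_sums_shift_subset[OF sv, of 0 1] by simp
      from Suc.prems(1-3) show ?case
      proof (cases rule: balanced_step)
        case 1
        have "S (Suc j) 0" using first Sj0 S0j by blast
        from SD[OF this 1(2), of "x - s / (v + lam)"] 1
        obtain q p where "q \<in> tail_sums (Suc j) z w" "x - s / (v + lam) = q + p"
          "p \<in> tail_sums 0 (s / (v + lam)^2) (3 - lam - 1 / (v + lam))"
          by (auto simp del: tail_sums.simps)
        moreover have "s / (v + lam) + p \<in> tail_sums 0 s v"
          using tail_sums_Suc_subset[OF sv, of 0] calculation(3) tail_sums.simps(2)[of 0 s v] by blast
        ultimately show ?thesis
          by (intro bexI[of _ "s / (v + lam) + p"] bexI[of _ q]) (auto simp del: tail_sums.simps)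
      next
        case (2 i)
        show ?thesis
        proof (cases i)
          case 0
          have "\<exists>p \<in> tail_sums 0 s (v + 1). \<exists>q \<in> tail_sums (Suc j) z w. x = p + q"
            using 2 0 Suc.prems by (intro Suc.IH) (auto simp: add_ac)
          then show ?thesis using sub by blast
        next
          case (Suc i')
          \<comment> \<open>Trimming by at least one digit already selects the left part of the
            second bridge, so depth \<open>j\<close> suffices from here on.\<close>
          have "tail_sums j z (w + real i) \<subseteq> tail_sums j z (w + 1)"
            using tail_sums_shift_subset[of z "w + 1" j i'] zw Suc by (simp add: add_ac)
          also have "\<dots> \<subseteq> tail_sums (Suc j) z w" by simp
          finally show ?thesis using SD[OF S0j 2(1) Suc.prems(2) 2(2)] sub by blast
        qed
      qed
    qed
    moreover have "\<exists>N. s / (v + real N)^2 < 3/2 * (z / w^2)" if "balanced s v z w" for s v z w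
    proof -
      have p: "s > 0" "v > 0" "z > 0" "w > 0"
        using that lam_bounds unfolding balanced_def by auto
      obtain N :: nat where N: "s / (3/2 * (z / w^2)) + 1 < real N" using reals_Archimedean2 by blast
      define Y where "Y = v + real N"
      have "s / (3/2 * (z / w^2)) < Y" unfolding Y_def using N p by simp
      moreover have "s / (3/2 * (z / w^2)) > 0" using p by simp
      moreover have "Y \<ge> 1" unfolding Y_def using N p calculation(2) by linarith
      moreover have "Y * 1 \<le> Y * Y" by (rule mult_left_mono) (use calculation in auto)
      ultimately have "s / (3/2 * (z / w^2)) < Y^2" unfolding power2_eq_square by linarith
      then have "s / Y^2 < 3/2 * (z / w^2)" using p \<open>Y \<ge> 1\<close> by (simp add: field_simps)
      then show ?thesis unfolding Y_def by blast
    qed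
    ultimately show ?thesis unfolding S_def by blast
  qed
  have "S k j" for k j
  proof (induction "k + j" arbitrary: k j rule: less_induct)
    case less
    show ?case
    proof (cases k)
      case (Suc k')
      then show ?thesis using less first by simp
    next
      case 0
      show ?thesis
      proof (cases j)
        case (Suc j')
        then show ?thesis using less zero 0 by simp
      next
        case j: 0
        show ?thesis unfolding S_def
        proof (intro allI impI)
          fix s v z w x :: real
          assume *: "balanced s v z w" "0 \<le> x" "x \<le> s / v + z / w"
          have "0 \<le> s / v" "0 \<le> z / w" using * lam_bounds unfolding balanced_def by auto
          then show "\<exists>p \<in> tail_sums k s v. \<exists>q \<in> tail_sums j z w. x = p + q"
            using * 0 j by (intro bexI[of _ "min x (s / v)"] bexI[of _ "x - min x (s / v)"]) auto
        qed
      qed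
    qed
  qed
  with assms show ?thesis by (intro SD)
qed

section \<open>Compactness\<close>

fun digit_tails :: "nat \<Rightarrow> nat \<Rightarrow> real set" where
  "digit_tails 0 n = {0..1 / (real n - lam)}"
| "digit_tails (Suc k) n = digit_tails k (Suc n) \<union> (\<lambda>t. 1 / (real n - t)) ` digit_tails k 3"

lemma inverse_3_minus_lam: "1 / (3 - lam) = lam"
  using lam_bounds lam_sq by (simp add: field_simps power2_eq_square)

lemma digit_tails_bounds:
  assumes "t \<in> digit_tails k n" "n \<ge> 3"
  shows "0 \<le> t \<and> t \<le> 1 / (real n - lam)"
  using assms
proof (induction k arbitrary: t n)
  case (Suc k)
  have n: "real n \<ge> 3" using Suc.prems by simp
  from Suc.prems(1) consider "t \<in> digit_tails k (Suc n)" |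
    u where "t = 1 / (real n - u)" "u \<in> digit_tails k 3"
    by auto
  then show ?case
  proof cases
    case 1
    then have "0 \<le> t \<and> t \<le> 1 / (real (Suc n) - lam)" using Suc.IH[OF 1] Suc.prems by simp
    moreover have "1 / (real (Suc n) - lam) \<le> 1 / (real n - lam)"
      using n lam_bounds by (intro divide_left_mono) auto
    ultimately show ?thesis by linarith
  next
    case 2
    then have "0 \<le> u \<and> u \<le> lam" using Suc.IH[of u 3] inverse_3_minus_lam by auto
    then show ?thesis unfolding 2 using n lam_bounds by (auto intro!: divide_left_mono)
  qed
qed simp

lemma digit_tails_3_bounds: "t \<in> digit_tails k 3 \<Longrightarrow> 0 \<le> t \<and> t \<le> lam"
  using digit_tails_bounds[of t k 3] inverse_3_minus_lam by auto

lemma compact_digit_tails: "n \<ge> 3 \<Longrightarrow> compact (digit_tails k n)"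
proof (induction k arbitrary: n)
  case (Suc k)
  have "real n - t \<noteq> 0" if "t \<in> digit_tails k 3" for t
    using digit_tails_3_bounds[OF that] lam_bounds Suc.prems by auto
  then have "continuous_on (digit_tails k 3) (\<lambda>t. 1 / (real n - t))"
    by (intro continuous_intros) auto
  then show ?case using Suc by (auto intro!: compact_Un compact_continuous_image)
qed simp

lemma digit_tails_Suc_subset: "n \<ge> 3 \<Longrightarrow> digit_tails (Suc k) n \<subseteq> digit_tails k n"
proof (induction k arbitrary: n)
  case 0
  show ?case
  proof
    fix t assume "t \<in> digit_tails (Suc 0) n"
    from digit_tails_bounds[OF this 0] show "t \<in> digit_tails 0 n" by simp
  qed
next
  case (Suc k)
  have "digit_tails (Suc k) (Suc n) \<subseteq> digit_tails k (Suc n)"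
    "digit_tails (Suc k) 3 \<subseteq> digit_tails k 3"
    using Suc.IH[of "Suc n"] Suc.IH[of 3] Suc.prems by (simp_all del: digit_tails.simps)
  then show ?case
    unfolding digit_tails.simps(2)[of "Suc k" n] digit_tails.simps(2)[of k n]
    by (auto simp del: digit_tails.simps)
qed

text \<open>With \<open>\<kappa> = q' / q\<close>, a bridge measured from its left end is the image
  of the digit set under \<open>s * t / (1 - \<kappa> * t)\<close>. Fixing the digit
  \<open>n\<close> replaces \<open>\<kappa>\<close> by \<open>1 / (n - \<kappa>)\<close>.\<close>

lemma tail_sums_digit_tails:
  assumes "u \<in> tail_sums k s (real n - \<kappa> - lam)" "s > 0" "0 \<le> \<kappa>" "\<kappa> \<le> lam" "n \<ge> 3"
  shows "\<exists>t \<in> digit_tails k n. u = s * t / (1 - \<kappa> * t)"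
  using assms
proof (induction k arbitrary: u s n \<kappa>)
  case 0
  define v where "v = real n - \<kappa> - lam"
  have v: "v > 0" unfolding v_def using 0 lam_bounds by auto
  have u: "0 \<le> u" "u \<le> s / v" using 0 unfolding v_def by auto
  have p: "s + \<kappa> * u > 0" using 0 u by (simp add: add_pos_nonneg)
  have "u * v \<le> s" using u v by (simp add: field_simps)
  \<comment> \<open>The witness solves \<open>u = s * t / (1 - \<kappa> * t)\<close> for
    \<open>t\<close>.\<close>
  then have "u / (s + \<kappa> * u) \<le> 1 / (real n - lam)"
    using p 0 lam_bounds unfolding v_def by (simp add: field_simps)
  then have "u / (s + \<kappa> * u) \<in> digit_tails 0 n" using u p by simp
  moreover have "1 - \<kappa> * (u / (s + \<kappa> * u)) = s / (s + \<kappa> * u)" using p by (simp add: field_simps)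
  then have "u = s * (u / (s + \<kappa> * u)) / (1 - \<kappa> * (u / (s + \<kappa> * u)))" using p 0 by simp
  ultimately show ?case by blast
next
  case (Suc k)
  have n: "real n \<ge> 3" using Suc.prems by simp
  define m where "m = real n - \<kappa>"
  have m: "m > 2" unfolding m_def using n Suc.prems lam_bounds by auto
  have 1: "real n - \<kappa> - lam + 1 = real (Suc n) - \<kappa> - lam" "real n - \<kappa> - lam + lam = m"
    unfolding m_def by auto
  from Suc.prems(1) consider "u \<in> tail_sums k s (real (Suc n) - \<kappa> - lam)" |
    r where "u = s / m + r" "r \<in> tail_sums k (s / m^2) (real 3 - 1 / m - lam)"
    unfolding tail_sums.simps 1 by (auto simp: algebra_simps)
  then show ?case
  proof cases
    case 1
    from Suc.IH[OF this] Suc.prems show ?thesis by auto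
  next
    case 2
    have "1 / m \<le> lam" using inverse_le_lam[of "m - lam"] Suc.prems n unfolding m_def by simp
    then obtain t where t: "t \<in> digit_tails k 3" "r = s / m^2 * t / (1 - 1 / m * t)"
      using Suc.IH[OF 2(2)] Suc.prems m by auto
    have "t \<le> lam" "0 \<le> t" using digit_tails_3_bounds t by auto
    then have nz: "m - t > 0" "real n - t > 0" using m n lam_bounds by auto
    have "1 - \<kappa> * (1 / (real n - t)) = (m - t) / (real n - t)"
      using nz unfolding m_def by (simp add: field_simps)
    then have "s * (1 / (real n - t)) / (1 - \<kappa> * (1 / (real n - t))) = s / (m - t)"
      using nz by simp
    also have "\<dots> = u"
    proof -
      have "1 - 1 / m * t = (m - t) / m" using m by (simp add: field_simps)
      then have "u = s / m + s * t / (m * (m - t))"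
        unfolding 2 t using m by (simp add: power2_eq_square)
      also have "\<dots> = s / (m - t)" using m nz by (simp add: divide_simps) (simp add: algebra_simps)
      finally show ?thesis by simp
    qed
    finally show ?thesis using t by (intro bexI[of _ "1 / (real n - t)"]) auto
  qed
qed

text \<open>This is the Cantor set \<open>D\<close>: zero and the finite or infinite expansions
  \<open>1 / (n1 - 1 / (n2 - ...))\<close> with digits at least 3.\<close>

definition minus_cfs :: "real set" where
  "minus_cfs = (\<Inter>k. digit_tails k 3)"

text \<open>Two equal bridges have ratio 1 and are not balanced, so the second one starts with its
  digit 3 trimmed away. The right ends still add up to more than \<open>1/2\<close>.\<close>

lemma balanced_initial: "balanced 1 (3 - lam) 1 (4 - lam)"
proof -
  have sq: "(3 - lam)^2 = 8 - 3 * lam" "(4 - lam)^2 = 15 - 5 * lam"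
    using lam_sq by (simp_all add: power2_eq_square algebra_simps)
  have cross: "a / b \<le> c / d" if "a * d \<le> c * b" "b > 0" "d > 0" for a b c d :: real
    using that by (simp add: divide_simps mult.commute)
  have "1 * (1 - lam) / ((4 - lam + lam) * (4 - lam + 1)) \<le> 1 * lam / ((3 - lam) * (3 - lam + lam))"
    using lam_bounds lam_sq by (intro cross) (auto simp: power2_eq_square algebra_simps)
  moreover have "1 * (1 - lam) / ((3 - lam + lam) * (3 - lam + 1)) \<le> 1 / (4 - lam)"
    using lam_bounds by (intro frac_le) auto
  moreover have "(3/2) / (4 - lam)^2 \<le> 1 / (3 - lam)^2"
    unfolding sq using lam_bounds by (intro cross) auto
  moreover have "(3/2 * lam^2) / (3 - lam)^2 \<le> 1 / (4 - lam)^2"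
    unfolding sq lam_sq
  proof (rule cross)
    have e: "(3 * lam - 1) * (15 - 5 * lam) = 5 * lam"
      using lam_sq by (simp add: power2_eq_square algebra_simps)
    show "3/2 * (3 * lam - 1) * (15 - 5 * lam) \<le> 1 * (8 - 3 * lam)"
      unfolding mult.assoc e using lam_bounds by simp
  qed (use lam_bounds in auto)
  moreover have "3 - 2 * lam \<le> 3 - lam" "3 - 2 * lam \<le> 4 - lam" using lam_bounds by auto
  ultimately show ?thesis
    unfolding balanced_def by (simp only: times_divide_eq_right mult_1_right zero_less_one simp_thms)
qed

lemma minus_cfs_sum:
  assumes "0 \<le> x" "x \<le> 1/2"
  obtains d e where "d \<in> minus_cfs" "e \<in> minus_cfs" "x = d + e"
proof -
  \<comment> \<open>One coordinate is enough to describe the pairs of depth \<open>k\<close>, since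
    the other summand is \<open>x - d\<close>.\<close>
  define F where "F k = digit_tails k 3 \<inter> (\<lambda>d. x - d) ` digit_tails k 3" for k
  have "(\<Inter>k. F k) \<noteq> {}"
  proof (rule compact_nest)
    fix k show "compact (F k)"
      unfolding F_def by (intro compact_Int compact_continuous_image compact_digit_tails continuous_intros) auto
    have "1/4 \<le> 1 / (3 - lam)" "1/4 \<le> 1 / (4 - lam)"
      using lam_bounds by (auto simp: field_simps)
    then have "x \<le> 1 / (3 - lam) + 1 / (4 - lam)" using assms by linarith
    from balanced_sum_surj[OF balanced_initial assms(1) this]
    obtain p q where pq: "p \<in> tail_sums k 1 (3 - lam)" "q \<in> tail_sums k 1 (4 - lam)" "x = p + q"
      by blast
    have "q \<in> tail_sums k 1 (3 - lam)"
      using tail_sums_shift_subset[of 1 "3 - lam" k 1] lam_bounds pq(2) by (auto simp: algebra_simps)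
    then have "p \<in> digit_tails k 3" "q \<in> digit_tails k 3"
      using tail_sums_digit_tails[of _ k 1 3 0] pq lam_bounds by auto
    then show "F k \<noteq> {}" unfolding F_def using pq(3) by auto
  next
    fix m n :: nat assume "m \<le> n"
    then have "digit_tails n 3 \<subseteq> digit_tails m 3"
      by (rule lift_Suc_antimono_le[rotated]) (rule digit_tails_Suc_subset, simp)
    then show "F n \<subseteq> F m" unfolding F_def by auto
  qed
  then obtain d where d: "\<And>k. d \<in> F k" by auto
  have "d \<in> digit_tails k 3" "x - d \<in> digit_tails k 3" for k using d[of k] unfolding F_def by auto
  then have "d \<in> minus_cfs" "x - d \<in> minus_cfs" unfolding minus_cfs_def by auto
  then show ?thesis using that[of d "x - d"] by simp
qed

section \<open>Continued fraction expansions\<close>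

text \<open>In \<open>t = 1 / (n - t')\<close> with \<open>0 \<le> t' < 1\<close> the digit
  \<open>n\<close> is the ceiling of \<open>1 / t\<close>.\<close>

definition lead :: "real \<Rightarrow> nat" where "lead t = nat \<lceil>1 / t\<rceil>"

definition rest :: "real \<Rightarrow> real" where "rest t = real (lead t) - 1 / t"

text \<open>Each digit skipped before \<open>lead t\<close> costs one level of depth, and removing
  the digit itself costs one more. The bounds on \<open>t\<close> show which branch of the union it
  comes from.\<close>

lemma rest_digit_tails:
  assumes "t \<in> digit_tails k n" "3 \<le> n" "n \<le> lead t" "lead t - n < k" "t > 0"
  shows "rest t \<in> digit_tails (k - 1 - (lead t - n)) 3"
  using assms
proof (induction k arbitrary: n)
  case (Suc k)
  have n: "real n \<ge> 3" using Suc.prems by simp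
  from Suc.prems(1) consider "t \<in> digit_tails k (Suc n)" |
    u where "t = 1 / (real n - u)" "u \<in> digit_tails k 3"
    by auto
  then show ?case
  proof cases
    case 1
    have "t \<le> 1 / (real (Suc n) - lam)" using digit_tails_bounds[OF 1] Suc.prems by simp
    then have "real (Suc n) - lam \<le> 1 / t" using n lam_bounds Suc.prems by (simp add: field_simps)
    then have "real n < 1 / t" using lam_bounds by simp
    then have "n < lead t" unfolding lead_def by linarith
    then show ?thesis using Suc.IH[OF 1] Suc.prems by simp
  next
    case 2
    have "0 \<le> u" "u \<le> lam" using digit_tails_3_bounds 2 by auto
    then have "1 / t = real n - u" "\<lceil>1 / t\<rceil> = int n"
      unfolding 2 using lam_bounds by (auto simp: ceiling_eq_iff)
    then have "lead t = n" "rest t = u" unfolding rest_def lead_def by auto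
    then show ?thesis using 2 by simp
  qed
qed simp

lemma minus_cfs_bounds: "t \<in> minus_cfs \<Longrightarrow> 0 \<le> t \<and> t \<le> lam"
  unfolding minus_cfs_def using digit_tails_3_bounds[of t 0] by blast

lemma minus_cfs_unfold:
  assumes "t \<in> minus_cfs" "t \<noteq> 0"
  shows "rest t \<in> minus_cfs" "3 \<le> lead t" "t = 1 / (real (lead t) - rest t)"
proof -
  have t: "0 < t" "t \<le> lam" using minus_cfs_bounds assms by force+
  have "t < 1/2" using t lam_bounds by simp
  then have "2 < 1 / t" using t by (simp add: field_simps)
  then show 3: "3 \<le> lead t" unfolding lead_def by linarith
  show "t = 1 / (real (lead t) - rest t)" unfolding rest_def by simp
  have "rest t \<in> digit_tails k 3" for k
  proof -
    \<comment> \<open>This depth leaves exactly \<open>k\<close> levels after the first digit is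
      removed.\<close>
    have "t \<in> digit_tails (Suc k + (lead t - 3)) 3" using assms(1) unfolding minus_cfs_def by blast
    from rest_digit_tails[OF this] 3 t show ?thesis by simp
  qed
  then show "rest t \<in> minus_cfs" unfolding minus_cfs_def by blast
qed

text \<open>One minus-digit yields two regular quotients: a \<open>1\<close>, then
  \<open>n - 1 - t = (n - 2) + (1 - t)\<close>, which has the original form with integer part
  \<open>n - 2\<close>.\<close>

lemma one_minus_unfold:
  fixes n t :: real
  assumes "n - t > 1"
  shows "1 - 1 / (n - t) = 1 / (1 + 1 / (n - 1 - t))"
  using assms by (simp add: divide_simps)

text \<open>The claim \<open>c 0 \<ge> m\<close> is needed because the last quotient exceeds the digit by one.\<close>
lemma finite_cf:
  assumes "t \<in> minus_cfs" "(rest ^^ i) t = 0"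
  shows "\<exists>c j. c 0 \<ge> m \<and> regular_cf c (enat (2 * j)) \<and> odd_quotients_one c (enat (2 * j)) \<and>
    cf_convergent c (2 * j) = of_int m + 1 - t"
  using assms
proof (induction i arbitrary: t m)
  case 0
  then show ?case
    by (intro exI[of _ "\<lambda>_. m + 1"] exI[of _ 0])
       (auto simp: regular_cf_def odd_quotients_one_def enat_0_iff)
next
  case (Suc i)
  show ?case
  proof (cases "t = 0")
    case True
    then show ?thesis
      by (intro exI[of _ "\<lambda>_. m + 1"] exI[of _ 0])
         (auto simp: regular_cf_def odd_quotients_one_def enat_0_iff)
  next
    case False
    note u = minus_cfs_unfold[OF Suc.prems(1) False]
    have "(rest ^^ i) (rest t) = 0" using Suc.prems(2) by (simp add: funpow_swap1)
    from Suc.IH[OF u(1) this, of "int (lead t) - 2"]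
    obtain c j where c: "c 0 \<ge> int (lead t) - 2" "regular_cf c (enat (2 * j))"
      "odd_quotients_one c (enat (2 * j))"
      "cf_convergent c (2 * j) = of_int (int (lead t) - 2) + 1 - rest t" by blast
    define c' where "c' k = (if k = 0 then m else if k = 1 then 1 else c (k - 2))" for k
    have "regular_cf c' (enat (2 * Suc j))"
      unfolding regular_cf_def
    proof (intro allI impI)
      fix k assume k: "0 < k \<and> enat k \<le> enat (2 * Suc j)"
      show "1 \<le> c' k"
      \<comment> \<open>Position 2 holds \<open>c 0\<close>, which \<open>regular_cf c\<close> does
        not control; there the bound \<open>c 0 \<ge> lead t - 2 \<ge> 1\<close> is used.\<close>
      proof (cases "k \<le> 2")
        case True
        then show ?thesis using k u(2) c(1) unfolding c'_def by (auto simp: le_Suc_eq numeral_2_eq_2)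
      next
        case False
        then show ?thesis using k c(2) unfolding c'_def regular_cf_def by auto
      qed
    qed
    moreover have "odd_quotients_one c' (enat (2 * Suc j))"
      using c(3) unfolding c'_def odd_quotients_one_def by auto
    moreover have "cf_convergent c' (2 * Suc j) = of_int m + 1 - t"
    proof -
      have "rest t \<le> lam" using minus_cfs_bounds u(1) by blast
      moreover have "3 \<le> real (lead t)" using u(2) by simp
      ultimately have "real (lead t) - rest t > 1" using lam_bounds by linarith
      from one_minus_unfold[OF this] u(3)
      have "1 - t = 1 / (1 + 1 / (real (lead t) - 1 - rest t))" by simp
      moreover have "cf_convergent c' (2 * Suc j) = of_int m + 1 / (1 + 1 / cf_convergent c (2 * j))"
        by (simp add: c'_def)
      ultimately show ?thesis unfolding c(4) by simp
    qed
    moreover have "c' 0 \<ge> m" by (simp add: c'_def)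
    ultimately show ?thesis by blast
  qed
qed

section \<open>Infinite expansions and their convergence\<close>

fun cf_quotients :: "int \<Rightarrow> real \<Rightarrow> nat \<Rightarrow> int" where
  "cf_quotients m t 0 = m"
| "cf_quotients m t (Suc 0) = 1"
| "cf_quotients m t (Suc (Suc k)) = cf_quotients (int (lead t) - 2) (rest t) k"

lemma cf_quotients_odd: "odd k \<Longrightarrow> cf_quotients m t k = 1"
  by (induction m t k rule: cf_quotients.induct) auto

definition infinite_minus_cfs :: "real set" where
  "infinite_minus_cfs = {t \<in> minus_cfs. \<forall>i. (rest ^^ i) t \<noteq> 0}"

lemma infinite_minus_cfs_rest:
  assumes "t \<in> infinite_minus_cfs"
  shows "t \<in> minus_cfs" "t \<noteq> 0" "rest t \<in> infinite_minus_cfs"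
proof -
  have *: "t \<in> minus_cfs" "(rest ^^ i) t \<noteq> 0" for i
    using assms unfolding infinite_minus_cfs_def by auto
  show "t \<in> minus_cfs" by fact
  show "t \<noteq> 0" using *(2)[of 0] by simp
  then have "rest t \<in> minus_cfs" using minus_cfs_unfold(1) * by blast
  moreover have "(rest ^^ i) (rest t) \<noteq> 0" for i
    using *(2)[of "Suc i"] by (simp only: funpow_Suc_right o_apply not_False_eq_True)
  ultimately show "rest t \<in> infinite_minus_cfs"
    unfolding infinite_minus_cfs_def by blast
qed

lemma cf_quotients_ge_1:
  assumes "t \<in> infinite_minus_cfs" "0 < k \<or> 1 \<le> m"
  shows "1 \<le> cf_quotients m t k"
  using assms
proof (induction m t k rule: cf_quotients.induct)
  case (3 m t k)
  note r = infinite_minus_cfs_rest[OF 3(2)]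
  have "1 \<le> int (lead t) - 2" using minus_cfs_unfold(2)[OF r(1,2)] by simp
  then show ?case using 3(1)[OF r(3)] by (simp only: cf_quotients.simps simp_thms)
qed auto

lemma cf_convergent_ge_1: "(\<And>i. 1 \<le> c i) \<Longrightarrow> 1 \<le> cf_convergent c n"
proof (induction n arbitrary: c)
  case (Suc n)
  have "1 \<le> cf_convergent (\<lambda>i. c (Suc i)) n" by (rule Suc.IH) (rule Suc.prems)
  moreover have "1 \<le> real_of_int (c 0)" using Suc.prems[of 0] by simp
  moreover have "0 \<le> 1 / cf_convergent (\<lambda>i. c (Suc i)) n" using calculation(1) by simp
  ultimately show ?case unfolding cf_convergent.simps by linarith
qed simp

text \<open>On \<open>[1, \<infinity>)\<close> the map \<open>1 / (1 + 1 / y)\<close> contracts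
  distances by the factor \<open>1/4\<close>, and it is applied once for every two
  quotients.\<close>

lemma cf_quotients_error:
  assumes "t \<in> infinite_minus_cfs"
  shows "\<bar>cf_convergent (cf_quotients m t) n - (of_int m + 1 - t)\<bar> \<le> (1/4) ^ (n div 2)"
  using assms
proof (induction n arbitrary: m t rule: induct_nat_012)
  case 0
  then show ?case using minus_cfs_bounds[of t] infinite_minus_cfs_rest(1)[of t] lam_bounds by simp
next
  case 1
  then show ?case using minus_cfs_bounds[of t] infinite_minus_cfs_rest(1)[of t] lam_bounds by simp
next
  case (ge2 n)
  note r = infinite_minus_cfs_rest[OF ge2.prems]
  note u = minus_cfs_unfold[OF r(1,2)]
  define Y where "Y = cf_convergent (cf_quotients (int (lead t) - 2) (rest t)) n"
  define Z where "Z = real (lead t) - 1 - rest t"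
  have rt: "rest t \<le> lam" using minus_cfs_bounds u(1) by blast
  have "3 \<le> real (lead t)" using u(2) by simp
  then have Z: "Z \<ge> 1" unfolding Z_def using rt lam_bounds by linarith
  have Y: "Y \<ge> 1" unfolding Y_def
    using u(2) by (intro cf_convergent_ge_1 cf_quotients_ge_1 r) auto
  have "1 - t = 1 / (1 + 1 / Z)"
    using one_minus_unfold[of "real (lead t)" "rest t"] u(3) Z unfolding Z_def by simp
  moreover have "cf_convergent (cf_quotients m t) (Suc (Suc n)) = of_int m + 1 / (1 + 1 / Y)"
    by (simp add: Y_def)
  ultimately have "cf_convergent (cf_quotients m t) (Suc (Suc n)) - (of_int m + 1 - t)
      = 1 / (1 + 1 / Y) - 1 / (1 + 1 / Z)" by simp
  also have "\<dots> = (Y - Z) / ((1 + Y) * (1 + Z))"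
    using Y Z by (simp add: divide_simps) (simp add: algebra_simps)
  finally have "\<bar>cf_convergent (cf_quotients m t) (Suc (Suc n)) - (of_int m + 1 - t)\<bar>
      = \<bar>Y - Z\<bar> / ((1 + Y) * (1 + Z))" using Y Z by (simp add: abs_mult)
  also have "\<dots> \<le> \<bar>Y - Z\<bar> / (2 * 2)"
    using Y Z by (intro divide_left_mono mult_mono) auto
  also have "\<bar>Y - Z\<bar> \<le> (1/4) ^ (n div 2)"
    using ge2.IH(1)[OF r(3), of "int (lead t) - 2"] unfolding Y_def Z_def by simp
  finally show ?case by simp
qed

lemma cf_has_value_infinite:
  assumes "t \<in> infinite_minus_cfs"
  shows "cf_has_value (cf_quotients m t) \<infinity> (of_int m + 1 - t)"
proof -
  have "(\<lambda>n. (1/4::real) ^ (n div 2)) \<longlonglongrightarrow> 0"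
    by (rule filterlim_compose[OF LIMSEQ_power_zero])
       (auto intro!: filterlim_at_top_div_const_nat)
  then have "(\<lambda>n. cf_convergent (cf_quotients m t) n - (of_int m + 1 - t)) \<longlonglongrightarrow> 0"
    by (rule Lim_null_comparison[rotated]) (use cf_quotients_error[OF assms] in auto)
  then show ?thesis unfolding cf_has_value_def by (simp add: LIM_zero_iff)
qed

lemma minus_cfs_cf:
  assumes "t \<in> minus_cfs"
  obtains c N where "regular_cf c N" "odd_quotients_one c N" "cf_has_value c N (of_int m + 1 - t)"
proof (cases "t \<in> infinite_minus_cfs")
  case True
  show ?thesis
  proof (rule that)
    show "regular_cf (cf_quotients m t) \<infinity>"
      unfolding regular_cf_def using cf_quotients_ge_1[OF True] by auto
    show "odd_quotients_one (cf_quotients m t) \<infinity>"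
      unfolding odd_quotients_one_def using cf_quotients_odd by auto
  qed (rule cf_has_value_infinite[OF True])
next
  case False
  then obtain i where "(rest ^^ i) t = 0" using assms unfolding infinite_minus_cfs_def by auto
  from finite_cf[OF assms this, of m] obtain c j where
    "regular_cf c (enat (2 * j))" "odd_quotients_one c (enat (2 * j))"
    "cf_convergent c (2 * j) = of_int m + 1 - t" by blast
  then show ?thesis using that[of c "enat (2 * j)"] unfolding cf_has_value_def by simp
qed

theorem theorem1p1:
  fixes x :: real
  assumes "\<exists>m::int. x - of_int m \<in> {1/2..1}"
  shows "\<exists>(a :: nat \<Rightarrow> int) (M :: enat) (b :: nat \<Rightarrow> int) (N :: enat) (u :: real) (v :: real).
           regular_cf a M \<and> odd_quotients_one a M \<and> cf_has_value a M u \<and>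
           regular_cf b N \<and> odd_quotients_one b N \<and> cf_has_value b N v \<and>
           x = u + v"
proof -
  obtain m :: int where m: "1/2 \<le> x - of_int m" "x - of_int m \<le> 1" using assms by auto
  then have "0 \<le> 1 - (x - of_int m)" "1 - (x - of_int m) \<le> 1/2" by auto
  then obtain d e where de: "d \<in> minus_cfs" "e \<in> minus_cfs" "1 - (x - of_int m) = d + e"
    using minus_cfs_sum by blast
  \<comment> \<open>Each expansion adds 1 to its integer part and
    \<open>x = m + 1 - (d + e)\<close>, so the two integer parts must sum to
    \<open>m - 1\<close>.\<close>
  obtain a M where a: "regular_cf a M" "odd_quotients_one a M"
    "cf_has_value a M (of_int (m - 1) + 1 - d)" using minus_cfs_cf[OF de(1)] .
  obtain b N where b: "regular_cf b N" "odd_quotients_one b N"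
    "cf_has_value b N (of_int 0 + 1 - e)" using minus_cfs_cf[OF de(2)] .
  have x: "x = (of_int (m - 1) + 1 - d) + (of_int 0 + 1 - e)" using de(3) by simp
  show ?thesis by (intro exI conjI) (fact a b x)+
qed

end
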